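(* Let $t\ge3$ and $n\ge3$ be integers, $g=(n^2+n)t-(n+2)$, $k=n^2t-(n+1)$. Then $Y(g,k)\in Z_5$. Precisely, writing $P_1=[nt-(n+2),\,n^2t-(2n+1)]$, $P_2=[(n^2-2n)t+n-1,\,(n^2-n)t+n-2]$, $P_3=[2nt-2n,\,2nt-2n]$, $P_4=[(n^2-n)t+n-2,\,(n^2-2n)t+n-1]$, $P_5=[n^2t-(2n+1),\,nt-(n+2)]$, the graph $Y(g,k)$ consists of the nodes $[[0,0]],P_1,\dots,P_5,[0,0]$ and exactly the edges: $[[0,0]]\to P_1$ labeled $(1,(n^2+n)t-(2n+3))$; $P_1\to P_2$ labeled $((n+1)t-(n+3),(n^2-1)t+n-2)$; $P_2\to P_3$ labeled $((n^2-n-2)t+n,(2n+2)t-(2n+2))$; $P_3\to P_4$ labeled $((2n+2)t-(2n+2),(n^2-n-2)t+n)$; $P_4\to P_5$ labeled $((n^2-1)t+n-2,(n+1)t-(n+3))$; $P_5\to P_1$ labeled $((n^2+n)t-(2n+2),(n^2+n)t-(2n+2))$; $P_5\to[0,0]$ labeled $((n^2+n)t-(2n+3),1)$; $[0,0]\to P_1$ labeled $(1,(n^2+n)t-(2n+3))$; and a self-loop at $[0,0]$ labeled $(0,0)$.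
   Context: For integers $2\le k<g$, the labeled directed graph $H(g,k)$ has a distinguished starting node $[[0,0]]$ and other nodes labeled by pairs $[R,r]$ of integers with $0\le R,r\le k-1$ (the node $[0,0]$ is distinct from the starting node). For a node $[P,p]$ (the starting node treated as $[0,0]$ here) there is an edge labeled $(A,a)$ from $[P,p]$ to $[R,r]$ whenever $0\le A,a\le g-1$ are integers, $0\le R,r\le k-1$, $ka+p=A+rg$ and $kA+R=a+Pg$; edges leaving the starting node additionally require $A\ne0\ne a$; no edge enters the starting node. $H(g,k)$ consists of the starting node and all nodes reachable from it. An even pivot node is a node $[a,a]$; an odd pivot node is a node $[r,s]$ with an edge to $[s,r]$; the starting node is not a pivot node. $Y(g,k)$ is obtained from $H(g,k)$ by deleting every node that is not a pivot node and from which no pivot node is reachable, with incident edges. A Young graph is a cyclic Young graph on $n$ nodes if its nodes other than the starting node and $[0,0]$ form the cyclic directed graph on $n$ nodes, and there are nodes $N_1$ and $N_2\ne[0,0]$ with $N_1$ directly preceding $N_2$, such that the only direct predecessor of $[0,0]$ other than itself is $N_1$ and the only direct successor of $[0,0]$ (other than itself) and of the starting node is $N_2$. $Z_n$ is the class of cyclic Young graphs on $n$ nodes. *)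

theory Defs
  imports "Graph_Theory.Digraph_Isomorphism"
begin

text \<open>
  \<open>Start\<close> is the distinguished starting node $[[0,0]]$; \<open>Node R r\<close> is the ordinary node
  $[R,r]$.  In particular \<open>Start \<noteq> Node 0 0\<close>.
\<close>

datatype young_node = Start | Node int int

fun coords :: "young_node \<Rightarrow> int \<times> int" where
  "coords Start = (0, 0)"
| "coords (Node R r) = (R, r)"

text \<open>An arc is a triple (source, label, target).\<close>

type_synonym young_arc = "young_node \<times> (int \<times> int) \<times> young_node"
type_synonym young_digraph = "(young_node, young_arc) pre_digraph"

definition all_nodes :: "int \<Rightarrow> young_node set" where
  "all_nodes k = insert Start {Node R r | R r. 0 \<le> R \<and> R \<le> k - 1 \<and> 0 \<le> r \<and> r \<le> k - 1}"

text \<open>The arcs between all admissible nodes, whether reachable from \<open>Start\<close> or not.\<close>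

definition all_arcs :: "int \<Rightarrow> int \<Rightarrow> young_arc set" where
  "all_arcs g k = {(u, (A, a), Node R r) | u A a R r P p.
     u \<in> all_nodes k \<and> Node R r \<in> all_nodes k \<and> coords u = (P, p) \<and>
     0 \<le> A \<and> A \<le> g - 1 \<and> 0 \<le> a \<and> a \<le> g - 1 \<and>
     k * a + p = A + r * g \<and> k * A + R = a + P * g \<and>
     (u = Start \<longrightarrow> A \<noteq> 0 \<and> a \<noteq> 0)}"

definition full_graph :: "int \<Rightarrow> int \<Rightarrow> young_digraph" where
  "full_graph g k =
     \<lparr> verts = all_nodes k, arcs = all_arcs g k, tail = fst, head = (\<lambda>e. snd (snd e)) \<rparr>"

definition H_graph :: "int \<Rightarrow> int \<Rightarrow> young_digraph" where
  "H_graph g k = full_graph g k \<restriction> {v. Start \<rightarrow>\<^sup>*\<^bsub>full_graph g k\<^esub> v}"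

definition even_pivot :: "young_digraph \<Rightarrow> young_node \<Rightarrow> bool" where
  "even_pivot G v \<longleftrightarrow> v \<in> verts G \<and> (\<exists>a. v = Node a a)"

definition odd_pivot :: "young_digraph \<Rightarrow> young_node \<Rightarrow> bool" where
  "odd_pivot G v \<longleftrightarrow> v \<in> verts G \<and> (\<exists>r s. v = Node r s \<and> Node r s \<rightarrow>\<^bsub>G\<^esub> Node s r)"

definition pivot :: "young_digraph \<Rightarrow> young_node \<Rightarrow> bool" where
  "pivot G v \<longleftrightarrow> even_pivot G v \<or> odd_pivot G v"

definition Y_graph :: "int \<Rightarrow> int \<Rightarrow> young_digraph" where
  "Y_graph g k = H_graph g k \<restriction>
     (verts (H_graph g k) -
       {v. \<not> pivot (H_graph g k) v \<and> \<not> (\<exists>w. pivot (H_graph g k) w \<and> v \<rightarrow>\<^sup>*\<^bsub>H_graph g k\<^esub> w)})"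

definition young_graph :: "young_digraph \<Rightarrow> bool" where
  "young_graph G \<longleftrightarrow> (\<exists>g k. 2 \<le> k \<and> k < g \<and> G = Y_graph g k)"

text \<open>The cyclic directed graph on \<open>n\<close> nodes: arc \<open>i\<close> leads from \<open>i\<close> to \<open>i + 1\<close> modulo \<open>n\<close>.\<close>

definition cyclic_digraph :: "nat \<Rightarrow> (nat, nat) pre_digraph" where
  "cyclic_digraph n =
     \<lparr> verts = {..<n}, arcs = {..<n}, tail = (\<lambda>i. i), head = (\<lambda>i. Suc i mod n) \<rparr>"

definition cyclic_young_graphs :: "nat \<Rightarrow> young_digraph set" (\<open>Z\<close>) where
  "Z n = {G. young_graph G \<and>
     digraph_iso (G \<restriction> (verts G - {Start, Node 0 0})) (cyclic_digraph n) \<and>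
     (\<exists>N1 \<in> verts G. \<exists>N2 \<in> verts G. N2 \<noteq> Node 0 0 \<and> N1 \<rightarrow>\<^bsub>G\<^esub> N2 \<and>
        {u. u \<rightarrow>\<^bsub>G\<^esub> Node 0 0} - {Node 0 0} = {N1} \<and>
        {v. Node 0 0 \<rightarrow>\<^bsub>G\<^esub> v} - {Node 0 0} = {N2} \<and>
        {v. Start \<rightarrow>\<^bsub>G\<^esub> v} = {N2})}"

end

theory Submission
  imports Defs
begin

text \<open>
  Since \<open>n * g - (n + 1) * k = 1\<close>, the linear system attached to a node can be inverted over the
  integers: two arcs leaving the same node differ by a combination of two explicit vectors, and the
  size constraints leave only five possible differences.  Hence one arc out of a node determines
  all others, and the nodes reachable from the start are exactly seven.
  All of them reach the pivot \<open>Node 0 0\<close>, so nothing is deleted on passing to \<open>Y_graph\<close>.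
\<close>

section \<open>Arc equations and well-formedness of the graphs\<close>

text \<open>The quantified coordinates become projections of \<open>coords\<close>, which takes the
  same value at \<open>Start\<close> and \<open>Node 0 0\<close>, so one pair of equations serves
  both.\<close>

lemma all_arcs_iff:
  "(u, (A, a), v) \<in> all_arcs g k \<longleftrightarrow>
     u \<in> all_nodes k \<and> v \<in> all_nodes k \<and> v \<noteq> Start \<and>
     0 \<le> A \<and> A \<le> g - 1 \<and> 0 \<le> a \<and> a \<le> g - 1 \<and>
     k * a + snd (coords u) = A + snd (coords v) * g \<and>
     k * A + fst (coords v) = a + fst (coords u) * g \<and>
     (u = Start \<longrightarrow> A \<noteq> 0 \<and> a \<noteq> 0)"
  unfolding all_arcs_def by (cases v; cases "coords u") auto

lemma Node_in_all_nodes: "Node R r \<in> all_nodes k \<longleftrightarrow> 0 \<le> R \<and> R < k \<and> 0 \<le> r \<and> r < k"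
  by (auto simp: all_nodes_def)

lemma Start_in_all_nodes: "Start \<in> all_nodes k"
  by (simp add: all_nodes_def)

lemma all_arcs_endpoints:
  assumes "e \<in> all_arcs g k"
  shows "fst e \<in> all_nodes k" and "snd (snd e) \<in> all_nodes k"
  using assms by (auto simp: all_arcs_def)

interpretation full_graph: wf_digraph "full_graph g k" for g k
  by unfold_locales (auto simp: full_graph_def all_arcs_endpoints)

interpretation H_graph: wf_digraph "H_graph g k" for g k
  unfolding H_graph_def by (rule full_graph.wellformed_induce_subgraph)

lemma full_graph_simps [simp]:
  "verts (full_graph g k) = all_nodes k" "arcs (full_graph g k) = all_arcs g k"
  "tail (full_graph g k) = fst" "head (full_graph g k) = (\<lambda>e. snd (snd e))"
  by (simp_all add: full_graph_def)

lemma H_graph_ends [simp]: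
  "tail (H_graph g k) = fst" "head (H_graph g k) = (\<lambda>e. snd (snd e))"
  by (simp_all add: H_graph_def)

lemma Y_graph_ends [simp]:
  "tail (Y_graph g k) = fst" "head (Y_graph g k) = (\<lambda>e. snd (snd e))"
  by (simp_all add: Y_graph_def)

lemma adj_iff:
  assumes "tail G = fst" "head G = (\<lambda>e. snd (snd e))"
  shows "u \<rightarrow>\<^bsub>G\<^esub> v \<longleftrightarrow> (\<exists>l. (u, l, v) \<in> arcs G)"
  unfolding arcs_ends_def arc_to_ends_def using assms by force

section \<open>Reachable nodes and deleted nodes\<close>

text \<open>A set that contains \<open>Start\<close> and is closed under arcs contains every
  reachable node. Closure also makes the condition on heads in the induced subgraph automatic, so
  only the tail needs to be tested.\<close>

lemma H_graph_eq:
  assumes Start: "Start \<in> S"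
    and closed: "\<And>e. e \<in> all_arcs g k \<Longrightarrow> fst e \<in> S \<Longrightarrow> snd (snd e) \<in> S"
    and reach: "\<And>v. v \<in> S \<Longrightarrow> Start \<rightarrow>\<^sup>*\<^bsub>full_graph g k\<^esub> v"
  shows "verts (H_graph g k) = S" and "arcs (H_graph g k) = {e \<in> all_arcs g k. fst e \<in> S}"
proof -
  have "v \<in> S" if "Start \<rightarrow>\<^sup>*\<^bsub>full_graph g k\<^esub> v" for v
    using that
  proof (induction rule: full_graph.reachable_induct)
    case (step x y)
    then show ?case using closed by (force simp: adj_iff)
  qed (rule Start)
  with reach have "{v. Start \<rightarrow>\<^sup>*\<^bsub>full_graph g k\<^esub> v} = S"
    by blast
  then show "verts (H_graph g k) = S" "arcs (H_graph g k) = {e \<in> all_arcs g k. fst e \<in> S}"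
    using closed by (auto simp: H_graph_def)
qed

text \<open>The node \<open>Node 0 0\<close> is an even pivot, so when every node reaches it the
  deleted set is empty; inducing on all vertices changes nothing because both ends of each arc are
  vertices.\<close>

lemma Y_graph_eq_H_graph:
  assumes "\<And>v. v \<in> verts (H_graph g k) \<Longrightarrow> v \<rightarrow>\<^sup>*\<^bsub>H_graph g k\<^esub> Node 0 0"
    and "Node 0 0 \<in> verts (H_graph g k)"
  shows "Y_graph g k = H_graph g k"
proof -
  have "pivot (H_graph g k) (Node 0 0)"
    using assms(2) by (simp add: pivot_def even_pivot_def)
  then have "verts (H_graph g k) - {v. \<not> pivot (H_graph g k) v \<and>
      \<not> (\<exists>w. pivot (H_graph g k) w \<and> v \<rightarrow>\<^sup>*\<^bsub>H_graph g k\<^esub> w)} = verts (H_graph g k)"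
    using assms(1) by blast
  then show ?thesis
    unfolding Y_graph_def using H_graph.wellformed
    by (intro pre_digraph.equality) auto
qed

section \<open>Recognising a cyclic Young graph on five nodes\<close>

lemma digraph_iso_cyclic_digraph_5:
  assumes "distinct [v0, v1, v2, v3, v4]"
    and "verts G = {v0, v1, v2, v3, v4}" and "arcs G = {e0, e1, e2, e3, e4}"
    and "map (tail G) [e0, e1, e2, e3, e4] = [v0, v1, v2, v3, v4]"
    and "map (head G) [e0, e1, e2, e3, e4] = [v1, v2, v3, v4, v0]"
  shows "digraph_iso G (cyclic_digraph 5)"
proof -
  \<comment> \<open>Numbering along the cycle. The default 4 is meant for \<open>v4\<close>; only
    the five vertices of \<open>G\<close> are ever looked up.\<close>
  define idx where "idx v = (if v = v0 then 0 else if v = v1 then 1 else if v = v2 then 2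
    else if v = v3 then 3 else 4 :: nat)" for v
  \<comment> \<open>An arc is sent to the number of its tail, because arc \<open>i\<close> of
    \<open>cyclic_digraph\<close> starts at \<open>i\<close>. This is injective since the five tails
    are distinct.\<close>
  define f where "f = \<lparr> iso_verts = idx, iso_arcs = idx \<circ> tail G,
    iso_head = (\<lambda>i. Suc i mod 5), iso_tail = (\<lambda>i. i) \<rparr>"
  have ends: "tail G e0 = v0" "tail G e1 = v1" "tail G e2 = v2" "tail G e3 = v3" "tail G e4 = v4"
      "head G e0 = v1" "head G e1 = v2" "head G e2 = v3" "head G e3 = v4" "head G e4 = v0"
    using assms(4,5) by simp_all
  have idx: "idx v0 = 0" "idx v1 = 1" "idx v2 = 2" "idx v3 = 3" "idx v4 = 4"
    using assms(1) by (auto simp: idx_def)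
  have "wf_digraph G"
    by (simp add: wf_digraph_def assms(2,3) ends)
  moreover have "inj_on idx {v0, v1, v2, v3, v4}" "inj_on (idx \<circ> tail G) {e0, e1, e2, e3, e4}"
    by (simp_all add: inj_on_def idx ends)
  ultimately have "pre_digraph.digraph_isomorphism G f"
    by (simp add: pre_digraph.digraph_isomorphism_def f_def assms(2,3) idx ends)
  moreover have "{..<5} = {0, 1, 2, 3, 4 :: nat}"
    by auto
  then have "cyclic_digraph 5 = app_iso f G"
    by (simp add: f_def app_iso_def cyclic_digraph_def assms(2,3) idx ends)
  ultimately show ?thesis
    unfolding digraph_iso_def by blast
qed

text \<open>Only the shape counts, so the labels stay arbitrary. The witnesses are \<open>p5\<close>
  for \<open>N1\<close> and \<open>p1\<close> for \<open>N2\<close>; the arc between them closes the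
  5-cycle.\<close>

lemma Y_graph_in_Z_5:
  assumes "2 \<le> k" "k < g"
    and dist: "distinct [p1, p2, p3, p4, p5, Node 0 0, Start]"
    and V: "verts (Y_graph g k) = {Start, p1, p2, p3, p4, p5, Node 0 0}"
    and A: "arcs (Y_graph g k) = {(Start, l0, p1), (p1, l1, p2), (p2, l2, p3), (p3, l3, p4),
      (p4, l4, p5), (p5, l5, p1), (p5, l6, Node 0 0), (Node 0 0, l7, p1), (Node 0 0, l8, Node 0 0)}"
  shows "Y_graph g k \<in> Z 5"
proof -
  let ?G = "Y_graph g k"
  have adj: "u \<rightarrow>\<^bsub>?G\<^esub> v \<longleftrightarrow> (u = Start \<and> v = p1) \<or> (u = p1 \<and> v = p2) \<or> (u = p2 \<and> v = p3) \<or>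
      (u = p3 \<and> v = p4) \<or> (u = p4 \<and> v = p5) \<or> (u = p5 \<and> v = p1) \<or> (u = p5 \<and> v = Node 0 0) \<or>
      (u = Node 0 0 \<and> v = p1) \<or> (u = Node 0 0 \<and> v = Node 0 0)" for u v
    unfolding adj_iff[OF Y_graph_ends] A by blast
  have "young_graph ?G"
    unfolding young_graph_def using assms(1,2) by blast
  moreover have "digraph_iso (?G \<restriction> (verts ?G - {Start, Node 0 0})) (cyclic_digraph 5)"
  proof (rule digraph_iso_cyclic_digraph_5)
    show "distinct [p1, p2, p3, p4, p5]"
      using dist by simp
    show "verts (?G \<restriction> (verts ?G - {Start, Node 0 0})) = {p1, p2, p3, p4, p5}"
      using dist by (simp add: V insert_Diff_if)
    \<comment> \<open>Splits the arc set one element at a time, so that distinctness decides each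
      arc; the four arcs touching \<open>Start\<close> or \<open>Node 0 0\<close> drop out.\<close>
    have filter_insert: "{e. e \<in> insert x B \<and> Q e} = (if Q x then insert x {e \<in> B. Q e} else {e \<in> B. Q e})"
      for x B and Q :: "young_arc \<Rightarrow> bool"
      by auto
    show "arcs (?G \<restriction> (verts ?G - {Start, Node 0 0})) =
        {(p1, l1, p2), (p2, l2, p3), (p3, l3, p4), (p4, l4, p5), (p5, l5, p1)}"
      using dist by (simp only: induce_subgraph_arcs A filter_insert) (simp add: V)
  qed simp_all
  moreover have "{u. u \<rightarrow>\<^bsub>?G\<^esub> Node 0 0} - {Node 0 0} = {p5}"
      "{v. Node 0 0 \<rightarrow>\<^bsub>?G\<^esub> v} - {Node 0 0} = {p1}" "{v. Start \<rightarrow>\<^bsub>?G\<^esub> v} = {p1}"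
    using dist unfolding adj by auto
  moreover have "p5 \<in> verts ?G" "p1 \<in> verts ?G" "p5 \<rightarrow>\<^bsub>?G\<^esub> p1" "p1 \<noteq> Node 0 0"
    using dist unfolding V adj by simp_all
  ultimately show ?thesis
    unfolding cyclic_young_graphs_def by blast
qed

section \<open>Parameters and the lattice of arc differences\<close>

text \<open>All node coordinates and labels are linear in \<open>t\<close>, \<open>n\<close>,
  \<open>m\<close>, \<open>q\<close>. Keeping the products \<open>m\<close> and \<open>q\<close> as
  symbols turns the range checks into linear arithmetic; only the arc equations need the products
  themselves.\<close>

locale young_parameters =
  fixes t n m q g k :: int
  assumes t: "t \<ge> 3" and n: "n \<ge> 3"
    and m: "m = n * t" and q: "q = n * m"
    and g: "g = q + m - (n + 2)" and k: "k = q - (n + 1)"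
begin

text \<open>The third bound is \<open>(n - 3) * (t - 3) >= 0\<close> expanded; the others multiply
  \<open>n >= 3\<close> or \<open>t >= 3\<close> by a nonnegative factor.\<close>

lemma bounds: "m \<ge> 3 * n" "m \<ge> 3 * t" "m \<ge> 3 * n + 3 * t - 9" "q \<ge> 3 * m"
  using t n mult_mono[of 3 n 3 t] mult_mono[of 3 t n n] mult_mono[of 3 n t t]
    mult_nonneg_nonneg[of "n - 3" "t - 3"] mult_right_mono[of 3 n m]
  by (auto simp: m q algebra_simps)

text \<open>A Bezout identity: the integer solutions of \<open>k * da - g * dr = dA\<close> are
  \<open>(da, dr) = s * (g, k) - dA * (n + 1, n)\<close> with \<open>s\<close> an integer.\<close>

lemma unimodular: "n * g - (n + 1) * k = 1"
  unfolding g k q by (simp add: algebra_simps)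

text \<open>The components are \<open>dA\<close>, \<open>da\<close>, \<open>dR\<close>,
  \<open>dr\<close>. Besides zero these are, up to sign, the lattice points with
  \<open>s = 1\<close> and \<open>dA = 1\<close> or \<open>dA = 2\<close>.\<close>

definition arc_differences :: "(int \<times> int \<times> int \<times> int) set" where
  "arc_differences = {(0, 0, 0, 0),
     (1, q + m - 2 * n - 3, m - n - 2, q - 2 * n - 1),
     (- 1, - (q + m - 2 * n - 3), - (m - n - 2), - (q - 2 * n - 1)),
     (2, q + m - 3 * n - 4, m - q - n - 2, q - 3 * n - 1),
     (- 2, - (q + m - 3 * n - 4), - (m - q - n - 2), - (q - 3 * n - 1))}"

text \<open>
  Here \<open>s\<close> is the second coordinate of the difference with respect to the lattice basis given by
  \<open>unimodular\<close>, the first one being \<open>dA\<close> itself.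
\<close>

lemma difference_in_arc_differences:
  fixes dA da dR dr :: int
  assumes eqs: "k * da = dA + dr * g" "k * dA + dR = da"
    and sizes: "\<bar>dA\<bar> < g" "\<bar>da\<bar> < g" "\<bar>dR\<bar> < k" "\<bar>dr\<bar> < k"
  shows "(dA, da, dR, dr) \<in> arc_differences"
proof -
  define s where "s = n * da - (n + 1) * dr"
  have da: "da = g * s - (n + 1) * dA"
    unfolding s_def using unimodular eqs(1) by algebra
  have dr: "dr = k * s - n * dA"
    unfolding s_def using unimodular eqs(1) by algebra
  \<comment> \<open>Here \<open>q\<close> arises as \<open>k + (n + 1)\<close>.\<close>
  have dR: "dR = g * s - q * dA"
    using eqs(2) unfolding da k by (simp add: algebra_simps)
  \<comment> \<open>This combination eliminates \<open>dA\<close>, since \<open>m * n = q\<close>;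
    the size bounds on \<open>dR\<close> and \<open>dr\<close> then bound \<open>s\<close>
    alone.\<close>
  have "s * (m * k - g) = m * dr - dR"
    unfolding dr dR q by (simp add: algebra_simps)
  moreover have "\<bar>m * dr - dR\<bar> < (m + 1) * k"
  proof -
    have "\<bar>m * dr\<bar> \<le> m * k"
      using sizes(4) bounds n by (simp add: abs_mult)
    then show ?thesis
      using sizes(3) by (simp add: algebra_simps)
  qed
  \<comment> \<open>Equivalent to \<open>k + 2 * g <= m * k\<close>. The constant 9 comes from
    \<open>m >= 3 * n >= 9\<close>.\<close>
  moreover have "(m + 1) * k \<le> 2 * (m * k - g)"
  proof -
    have "9 * k \<le> m * k"
      using bounds n k by (intro mult_right_mono) auto
    moreover have "k + 2 * g \<le> 9 * k"
      using bounds n by (simp add: g k)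
    ultimately show ?thesis
      by (simp add: algebra_simps)
  qed
  ultimately have lt: "\<bar>s * (m * k - g)\<bar> < 2 * (m * k - g)"
    by linarith
  then have "m * k - g > 0"
    using le_less_trans[OF abs_ge_zero lt] by simp
  with lt have "\<bar>s\<bar> < 2"
    by (simp only: abs_mult abs_of_pos mult_less_cancel_right_pos)
  then consider "s = 0" | "s = 1" | "s = - 1"
    by linarith
  then show ?thesis
  proof cases
    case 1
    have "q * \<bar>dA\<bar> < k"
      using sizes(3) dR 1 bounds n by (simp add: abs_mult)
    also have "k < q * 1"
      using n k by simp
    finally have "dA = 0"
      using bounds n by simp
    then show ?thesis
      using da dr dR 1 by (simp add: arc_differences_def)
  next
    case 2
    \<comment> \<open>With \<open>s = 1\<close>, the bound on \<open>dR = g - q * dA\<close> puts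
      \<open>q * dA\<close> strictly between \<open>g - k > 0\<close> and
      \<open>g + k < 3 * q\<close>.\<close>
    have "0 < q * dA"
      using sizes(3) dR 2 bounds n k g by auto
    then have "0 < dA"
      using mult_less_cancel_left_pos[of q 0 dA] bounds n by linarith
    have "q * dA < g + k"
      using sizes(3) dR 2 by simp
    also have "g + k < q * 3"
      using bounds n g k by simp
    finally have "dA < 3"
      using bounds n by simp
    with \<open>0 < dA\<close> consider "dA = 1" | "dA = 2"
      by linarith
    then show ?thesis
      using da dr dR 2 by cases (simp_all add: arc_differences_def g k)
  next
    case 3
    have "q * dA < 0"
      using sizes(3) dR 3 bounds n k g by auto
    then have "dA < 0"
      using mult_less_cancel_left_pos[of q dA 0] bounds n by linarith
    have "q * (- 3) < - (g + k)"
      using bounds n g k by simp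
    also have "- (g + k) < q * dA"
      using sizes(3) dR 3 by simp
    finally have "- 3 < dA"
      using mult_less_cancel_left_pos[of q "- 3" dA] bounds n by linarith
    with \<open>dA < 0\<close> consider "dA = - 1" | "dA = - 2"
      by linarith
    then show ?thesis
      using da dr dR 3 by cases (simp_all add: arc_differences_def g k)
  qed
qed

section \<open>The arcs leaving each node\<close>

text \<open>Subtracting the equations of a reference solution at \<open>u\<close> cancels the
  coordinates of \<open>u\<close> and leaves the homogeneous system; values in a common range differ
  by less than its length.\<close>

lemma arcs_from_differences:
  assumes "k * a0 + snd (coords u) = A0 + r0 * g" "k * A0 + R0 = a0 + fst (coords u) * g"
    and "0 \<le> A0" "A0 < g" "0 \<le> a0" "a0 < g" "0 \<le> R0" "R0 < k" "0 \<le> r0" "r0 < k"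
    and "(u, (A, a), Node R r) \<in> all_arcs g k"
  shows "(A - A0, a - a0, R - R0, r - r0) \<in> arc_differences"
proof (rule difference_in_arc_differences)
  show "k * (a - a0) = A - A0 + (r - r0) * g" "k * (A - A0) + (R - R0) = a - a0"
    using assms by (auto simp: all_arcs_iff algebra_simps)
  show "\<bar>A - A0\<bar> < g" "\<bar>a - a0\<bar> < g" "\<bar>R - R0\<bar> < k" "\<bar>r - r0\<bar> < k"
    using assms by (auto simp: all_arcs_iff Node_in_all_nodes)
qed

lemma arc_range:
  assumes "(u, (A, a), Node R r) \<in> all_arcs g k"
  shows "0 \<le> A" "A < g" "0 \<le> a" "a < g" "0 \<le> R" "R < k" "0 \<le> r" "r < k"
  using assms by (auto simp: all_arcs_iff Node_in_all_nodes)

text \<open>Reversing an arc while swapping its label and the coordinates at both ends just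
  exchanges the two arc equations. This duality pairs \<open>P1\<close> with \<open>P5\<close> and
  \<open>P2\<close> with \<open>P4\<close>, and fixes \<open>P3\<close> and the arc from
  \<open>P5\<close> to \<open>P1\<close>.\<close>

abbreviation "P1 \<equiv> Node (m - (n + 2)) (q - (2 * n + 1))"
abbreviation "P2 \<equiv> Node (q - 2 * m + n - 1) (q - m + n - 2)"
abbreviation "P3 \<equiv> Node (2 * m - 2 * n) (2 * m - 2 * n)"
abbreviation "P4 \<equiv> Node (q - m + n - 2) (q - 2 * m + n - 1)"
abbreviation "P5 \<equiv> Node (q - (2 * n + 1)) (m - (n + 2))"

lemmas sizes = t n bounds g k

text \<open>With the zero loop as reference the differences are the arcs themselves. Negative
  \<open>dA\<close> is impossible, and \<open>dA = 2\<close> would make \<open>R\<close>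
  negative.\<close>

lemma arcs_from_zero:
  "(Node 0 0, (A, a), Node R r) \<in> all_arcs g k \<longleftrightarrow>
     (A, a, Node R r) \<in> {(0, 0, Node 0 0), (1, q + m - (2 * n + 3), P1)}" (is "?L \<longleftrightarrow> ?R")
proof
  assume ?L
  have "(A, a, R, r) \<in> arc_differences"
    using arcs_from_differences[of 0 "Node 0 0" 0 0 0 A a R r] \<open>?L\<close> sizes by simp
  then show ?R
    using arc_range[OF \<open>?L\<close>] t n bounds by (auto simp: arc_differences_def g k)
next
  assume ?R
  moreover have "k * (q + m - (2 * n + 3)) = 1 + (q - (2 * n + 1)) * g"
      "k + (m - (n + 2)) = q + m - (2 * n + 3)"
    unfolding g k q m by algebra+
  ultimately show ?L
    using sizes by (auto simp: all_arcs_iff Node_in_all_nodes)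
qed

text \<open>The equations are those of \<open>Node 0 0\<close>; the nonzero label condition removes
  exactly the loop.\<close>

lemma arcs_from_Start:
  "(Start, (A, a), Node R r) \<in> all_arcs g k \<longleftrightarrow>
     (A, a, Node R r) = (1, q + m - (2 * n + 3), P1)"
proof -
  have "(Start, (A, a), Node R r) \<in> all_arcs g k \<longleftrightarrow>
      A \<noteq> 0 \<and> a \<noteq> 0 \<and> (Node 0 0, (A, a), Node R r) \<in> all_arcs g k"
    using sizes by (auto simp: all_arcs_iff Node_in_all_nodes Start_in_all_nodes)
  then show ?thesis
    unfolding arcs_from_zero using n bounds by auto
qed

lemma arcs_from_P1:
  "(P1, (A, a), Node R r) \<in> all_arcs g k \<longleftrightarrow>
     (A, a, Node R r) = (m + t - (n + 3), q - t + n - 2, P2)" (is "?L \<longleftrightarrow> ?R")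
proof -
  have eqs: "k * (q - t + n - 2) + (q - (2 * n + 1)) = (m + t - (n + 3)) + (q - m + n - 2) * g"
      "k * (m + t - (n + 3)) + (q - 2 * m + n - 1) = (q - t + n - 2) + (m - (n + 2)) * g"
    unfolding g k q m by algebra+
  show ?thesis
  proof
    assume ?L
    have "(A - (m + t - (n + 3)), a - (q - t + n - 2),
        R - (q - 2 * m + n - 1), r - (q - m + n - 2)) \<in> arc_differences"
      using eqs sizes \<open>?L\<close> by (intro arcs_from_differences[where u = P1]) auto
    \<comment> \<open>Positive \<open>dA\<close> pushes \<open>r\<close> to at least
      \<open>k\<close>, and \<open>dA = - 1\<close> makes \<open>r\<close> negative. For
      \<open>dA = - 2\<close> it is \<open>R\<close> that reaches \<open>k\<close>, by
      \<open>q >= 3 * m\<close>.\<close>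
    then show ?R
      using arc_range[OF \<open>?L\<close>] t n bounds by (auto simp: arc_differences_def g k)
  next
    assume ?R
    then show ?L
      using eqs sizes by (auto simp: all_arcs_iff Node_in_all_nodes)
  qed
qed

lemma arcs_from_P2:
  "(P2, (A, a), Node R r) \<in> all_arcs g k \<longleftrightarrow>
     (A, a, Node R r) = (q - m - 2 * t + n, 2 * m + 2 * t - (2 * n + 2), P3)" (is "?L \<longleftrightarrow> ?R")
proof -
  have eqs: "k * (2 * m + 2 * t - (2 * n + 2)) + (q - m + n - 2)
        = (q - m - 2 * t + n) + (2 * m - 2 * n) * g"
      "k * (q - m - 2 * t + n) + (2 * m - 2 * n)
        = (2 * m + 2 * t - (2 * n + 2)) + (q - 2 * m + n - 1) * g"
    unfolding g k q m by algebra+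
  show ?thesis
  proof
    assume ?L
    have "(A - (q - m - 2 * t + n), a - (2 * m + 2 * t - (2 * n + 2)),
        R - (2 * m - 2 * n), r - (2 * m - 2 * n)) \<in> arc_differences"
      using eqs sizes \<open>?L\<close> by (intro arcs_from_differences[where u = P2]) auto
    \<comment> \<open>Each nonzero difference moves \<open>r\<close> out of its range.\<close>
    then show ?R
      using arc_range[OF \<open>?L\<close>] t n bounds by (auto simp: arc_differences_def g k)
  next
    assume ?R
    then show ?L
      using eqs sizes by (auto simp: all_arcs_iff Node_in_all_nodes)
  qed
qed

lemma arcs_from_P3:
  "(P3, (A, a), Node R r) \<in> all_arcs g k \<longleftrightarrow>
     (A, a, Node R r) = (2 * m + 2 * t - (2 * n + 2), q - m - 2 * t + n, P4)" (is "?L \<longleftrightarrow> ?R")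
proof -
  have eqs: "k * (q - m - 2 * t + n) + (2 * m - 2 * n)
        = (2 * m + 2 * t - (2 * n + 2)) + (q - 2 * m + n - 1) * g"
      "k * (2 * m + 2 * t - (2 * n + 2)) + (q - m + n - 2)
        = (q - m - 2 * t + n) + (2 * m - 2 * n) * g"
    unfolding g k q m by algebra+
  show ?thesis
  proof
    assume ?L
    have "(A - (2 * m + 2 * t - (2 * n + 2)), a - (q - m - 2 * t + n),
        R - (q - m + n - 2), r - (q - 2 * m + n - 1)) \<in> arc_differences"
      using eqs sizes \<open>?L\<close> by (intro arcs_from_differences[where u = P3]) auto
    then show ?R
      using arc_range[OF \<open>?L\<close>] t n bounds by (auto simp: arc_differences_def g k)
  next
    assume ?R
    then show ?L
      using eqs sizes by (auto simp: all_arcs_iff Node_in_all_nodes)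
  qed
qed

lemma arcs_from_P4:
  "(P4, (A, a), Node R r) \<in> all_arcs g k \<longleftrightarrow>
     (A, a, Node R r) = (q - t + n - 2, m + t - (n + 3), P5)" (is "?L \<longleftrightarrow> ?R")
proof -
  have eqs: "k * (m + t - (n + 3)) + (q - 2 * m + n - 1) = (q - t + n - 2) + (m - (n + 2)) * g"
      "k * (q - t + n - 2) + (q - (2 * n + 1)) = (m + t - (n + 3)) + (q - m + n - 2) * g"
    unfolding g k q m by algebra+
  show ?thesis
  proof
    assume ?L
    have "(A - (q - t + n - 2), a - (m + t - (n + 3)),
        R - (q - (2 * n + 1)), r - (m - (n + 2))) \<in> arc_differences"
      using eqs sizes \<open>?L\<close> by (intro arcs_from_differences[where u = P4]) auto
    \<comment> \<open>The delicate case is \<open>dA = 2\<close>: \<open>r < k\<close> needs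
      \<open>m < 3 * n + 2\<close>, whereas \<open>R >= 0\<close> needs
      \<open>m >= 3 * n + 3\<close>.\<close>
    then show ?R
      using arc_range[OF \<open>?L\<close>] t n bounds by (auto simp: arc_differences_def g k)
  next
    assume ?R
    then show ?L
      using eqs sizes by (auto simp: all_arcs_iff Node_in_all_nodes)
  qed
qed

lemma arcs_from_P5:
  "(P5, (A, a), Node R r) \<in> all_arcs g k \<longleftrightarrow>
     (A, a, Node R r) \<in> {(q + m - (2 * n + 2), q + m - (2 * n + 2), P1),
       (q + m - (2 * n + 3), 1, Node 0 0)}" (is "?L \<longleftrightarrow> ?R")
proof -
  \<comment> \<open>The factor 1 and the zero terms keep the literal shape of the arc equations, so
    that these facts match the goals below. The third equation serves as both equations of the arc
    to \<open>P1\<close>, which is self-dual.\<close>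
  have eqs: "k * 1 + (m - (n + 2)) = (q + m - (2 * n + 3)) + 0 * g"
      "k * (q + m - (2 * n + 3)) + 0 = 1 + (q - (2 * n + 1)) * g"
      "k * (q + m - (2 * n + 2)) + (m - (n + 2)) = (q + m - (2 * n + 2)) + (q - (2 * n + 1)) * g"
    unfolding g k q m by algebra+
  show ?thesis
  proof
    assume ?L
    \<comment> \<open>The reference is the arc to \<open>Node 0 0\<close>; the difference with
      \<open>dA = 1\<close> then yields the arc to \<open>P1\<close>, and the one with
      \<open>dA = 2\<close> makes \<open>R\<close> negative.\<close>
    have "(A - (q + m - (2 * n + 3)), a - 1, R - 0, r - 0) \<in> arc_differences"
      by (rule arcs_from_differences[OF _ _ _ _ _ _ _ _ _ _ \<open>?L\<close>])
        (simp only: coords.simps fst_conv snd_conv eqs | use t n bounds in \<open>simp add: g k\<close>)+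
    then show ?R
      using arc_range[OF \<open>?L\<close>] t n bounds by (auto simp: arc_differences_def g k)
  next
    have "(P5, (q + m - (2 * n + 2), q + m - (2 * n + 2)), P1) \<in> all_arcs g k"
        "(P5, (q + m - (2 * n + 3), 1), Node 0 0) \<in> all_arcs g k"
      unfolding all_arcs_iff Node_in_all_nodes coords.simps fst_conv snd_conv
      by (intro conjI; (rule eqs | use t n bounds in \<open>simp add: g k\<close>))+
    moreover assume ?R
    ultimately show ?L
      by auto
  qed
qed

section \<open>Assembling the graph\<close>

definition young_nodes :: "young_node set" where
  "young_nodes = {Start, P1, P2, P3, P4, P5, Node 0 0}"

definition young_arcs :: "young_arc set" where
  "young_arcs = {
      (Start, (1, q + m - (2 * n + 3)), P1),
      (P1, (m + t - (n + 3), q - t + n - 2), P2),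
      (P2, (q - m - 2 * t + n, 2 * m + 2 * t - (2 * n + 2)), P3),
      (P3, (2 * m + 2 * t - (2 * n + 2), q - m - 2 * t + n), P4),
      (P4, (q - t + n - 2, m + t - (n + 3)), P5),
      (P5, (q + m - (2 * n + 2), q + m - (2 * n + 2)), P1),
      (P5, (q + m - (2 * n + 3), 1), Node 0 0),
      (Node 0 0, (1, q + m - (2 * n + 3)), P1),
      (Node 0 0, (0, 0), Node 0 0)}"

lemma arcs_from_young_nodes: "{e \<in> all_arcs g k. fst e \<in> young_nodes} = young_arcs"
proof (intro set_eqI iffI)
  fix e assume "e \<in> {e \<in> all_arcs g k. fst e \<in> young_nodes}"
  moreover obtain u A a v where e: "e = (u, (A, a), v)"
    by (metis prod.exhaust)
  moreover obtain R r where v: "v = Node R r"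
    using calculation by (cases v) (auto simp: all_arcs_iff)
  ultimately have arc: "(u, (A, a), Node R r) \<in> all_arcs g k" and u: "u \<in> young_nodes"
    by auto
  have "(u, (A, a), Node R r) \<in> young_arcs"
    using u unfolding young_nodes_def
    apply (elim insertE emptyE)
          apply (use arc in \<open>simp_all add: arcs_from_Start arcs_from_zero arcs_from_P1
            arcs_from_P2 arcs_from_P3 arcs_from_P4 arcs_from_P5 young_arcs_def\<close>)
    by auto
  then show "e \<in> young_arcs"
    by (simp add: e v)
next
  fix e assume "e \<in> young_arcs"
  then show "e \<in> {e \<in> all_arcs g k. fst e \<in> young_nodes}"
    unfolding young_arcs_def
    by (elim insertE emptyE) (simp_all add: arcs_from_Start arcs_from_zero arcs_from_P1
      arcs_from_P2 arcs_from_P3 arcs_from_P4 arcs_from_P5 young_nodes_def)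
qed

lemma distinct_young_nodes: "distinct [P1, P2, P3, P4, P5, Node 0 0]"
  using sizes by auto

text \<open>A path through all seven nodes. It is used twice: in \<open>full_graph\<close> to reach
  each node from \<open>Start\<close>, and in \<open>H_graph\<close> to reach the pivot
  \<open>Node 0 0\<close> from each node.\<close>

lemma young_arcs_adj:
  assumes "tail G = fst" "head G = (\<lambda>e. snd (snd e))" "young_arcs \<subseteq> arcs G"
  shows "Start \<rightarrow>\<^bsub>G\<^esub> P1" "P1 \<rightarrow>\<^bsub>G\<^esub> P2" "P2 \<rightarrow>\<^bsub>G\<^esub> P3" "P3 \<rightarrow>\<^bsub>G\<^esub> P4" "P4 \<rightarrow>\<^bsub>G\<^esub> P5" "P5 \<rightarrow>\<^bsub>G\<^esub> Node 0 0"
  using assms(3) unfolding adj_iff[OF assms(1,2)] young_arcs_def insert_subset by blast+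

lemma H_graph_young:
  "verts (H_graph g k) = young_nodes" "arcs (H_graph g k) = young_arcs"
proof -
  have "young_arcs \<subseteq> arcs (full_graph g k)"
    unfolding full_graph_simps arcs_from_young_nodes[symmetric] by blast
  note adj = young_arcs_adj[OF full_graph_simps(3,4) this]
  have 0: "Start \<rightarrow>\<^sup>*\<^bsub>full_graph g k\<^esub> Start"
    by (simp add: Start_in_all_nodes)
  have 1: "Start \<rightarrow>\<^sup>*\<^bsub>full_graph g k\<^esub> P1"
    by (rule full_graph.reachable_adj_trans[OF 0 adj(1)])
  have 2: "Start \<rightarrow>\<^sup>*\<^bsub>full_graph g k\<^esub> P2"
    by (rule full_graph.reachable_adj_trans[OF 1 adj(2)])
  have 3: "Start \<rightarrow>\<^sup>*\<^bsub>full_graph g k\<^esub> P3"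
    by (rule full_graph.reachable_adj_trans[OF 2 adj(3)])
  have 4: "Start \<rightarrow>\<^sup>*\<^bsub>full_graph g k\<^esub> P4"
    by (rule full_graph.reachable_adj_trans[OF 3 adj(4)])
  have 5: "Start \<rightarrow>\<^sup>*\<^bsub>full_graph g k\<^esub> P5"
    by (rule full_graph.reachable_adj_trans[OF 4 adj(5)])
  have 6: "Start \<rightarrow>\<^sup>*\<^bsub>full_graph g k\<^esub> Node 0 0"
    by (rule full_graph.reachable_adj_trans[OF 5 adj(6)])
  have "\<forall>v\<in>young_nodes. Start \<rightarrow>\<^sup>*\<^bsub>full_graph g k\<^esub> v"
    unfolding young_nodes_def ball_simps by (intro conjI TrueI 0 1 2 3 4 5 6)
  then have reach: "Start \<rightarrow>\<^sup>*\<^bsub>full_graph g k\<^esub> v" if "v \<in> young_nodes" for v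
    using that by blast
  have closed: "snd (snd e) \<in> young_nodes" if "e \<in> all_arcs g k" "fst e \<in> young_nodes" for e
  proof -
    have "e \<in> young_arcs"
      using that arcs_from_young_nodes by blast
    then show ?thesis
      unfolding young_arcs_def by (elim insertE emptyE) (simp_all add: young_nodes_def)
  qed
  have "Start \<in> young_nodes"
    by (simp add: young_nodes_def)
  from H_graph_eq[OF this closed reach]
  show "verts (H_graph g k) = young_nodes" "arcs (H_graph g k) = young_arcs"
    by (simp_all add: arcs_from_young_nodes)
qed

lemma Y_graph_young: "Y_graph g k = H_graph g k"
proof (rule Y_graph_eq_H_graph)
  show "Node 0 0 \<in> verts (H_graph g k)"
    by (simp add: H_graph_young young_nodes_def)
  note adj = young_arcs_adj[OF H_graph_ends equalityD2[OF H_graph_young(2)]]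
  have 6: "Node 0 0 \<rightarrow>\<^sup>*\<^bsub>H_graph g k\<^esub> Node 0 0"
    by (simp add: H_graph_young young_nodes_def)
  have 5: "P5 \<rightarrow>\<^sup>*\<^bsub>H_graph g k\<^esub> Node 0 0"
    by (rule H_graph.adj_reachable_trans[OF adj(6) 6])
  have 4: "P4 \<rightarrow>\<^sup>*\<^bsub>H_graph g k\<^esub> Node 0 0"
    by (rule H_graph.adj_reachable_trans[OF adj(5) 5])
  have 3: "P3 \<rightarrow>\<^sup>*\<^bsub>H_graph g k\<^esub> Node 0 0"
    by (rule H_graph.adj_reachable_trans[OF adj(4) 4])
  have 2: "P2 \<rightarrow>\<^sup>*\<^bsub>H_graph g k\<^esub> Node 0 0"
    by (rule H_graph.adj_reachable_trans[OF adj(3) 3])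
  have 1: "P1 \<rightarrow>\<^sup>*\<^bsub>H_graph g k\<^esub> Node 0 0"
    by (rule H_graph.adj_reachable_trans[OF adj(2) 2])
  have 0: "Start \<rightarrow>\<^sup>*\<^bsub>H_graph g k\<^esub> Node 0 0"
    by (rule H_graph.adj_reachable_trans[OF adj(1) 1])
  have "\<forall>v\<in>young_nodes. v \<rightarrow>\<^sup>*\<^bsub>H_graph g k\<^esub> Node 0 0"
    unfolding young_nodes_def ball_simps by (intro conjI TrueI 0 1 2 3 4 5 6)
  then show "v \<rightarrow>\<^sup>*\<^bsub>H_graph g k\<^esub> Node 0 0" if "v \<in> verts (H_graph g k)" for v
    using that unfolding H_graph_young by blast
qed

lemma verts_Y_graph: "verts (Y_graph g k) = young_nodes"
  and arcs_Y_graph: "arcs (Y_graph g k) = young_arcs"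
  by (simp_all add: Y_graph_young H_graph_young)

lemma Y_graph_in_Z: "Y_graph g k \<in> Z 5"
proof (rule Y_graph_in_Z_5)
  show "2 \<le> k" "k < g"
    using sizes by auto
  show "distinct [P1, P2, P3, P4, P5, Node 0 0, Start]"
    using distinct_young_nodes by simp
  show "verts (Y_graph g k) = {Start, P1, P2, P3, P4, P5, Node 0 0}"
    unfolding verts_Y_graph young_nodes_def ..
qed (rule arcs_Y_graph[unfolded young_arcs_def])

end

section \<open>Return to the explicit polynomials in \<open>n\<close> and \<open>t\<close>\<close>

theorem theorem6:
  fixes t n g k :: int and P1 P2 P3 P4 P5 :: young_node
  assumes "t \<ge> 3" and "n \<ge> 3"
    and "g = (n^2 + n) * t - (n + 2)"
    and "k = n^2 * t - (n + 1)"
    and "P1 = Node (n * t - (n + 2)) (n^2 * t - (2 * n + 1))"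
    and "P2 = Node ((n^2 - 2 * n) * t + n - 1) ((n^2 - n) * t + n - 2)"
    and "P3 = Node (2 * n * t - 2 * n) (2 * n * t - 2 * n)"
    and "P4 = Node ((n^2 - n) * t + n - 2) ((n^2 - 2 * n) * t + n - 1)"
    and "P5 = Node (n^2 * t - (2 * n + 1)) (n * t - (n + 2))"
  shows "Y_graph g k \<in> Z 5 \<and>
    verts (Y_graph g k) = {Start, P1, P2, P3, P4, P5, Node 0 0} \<and>
    arcs (Y_graph g k) = {
      (Start, (1, (n^2 + n) * t - (2 * n + 3)), P1),
      (P1, ((n + 1) * t - (n + 3), (n^2 - 1) * t + n - 2), P2),
      (P2, ((n^2 - n - 2) * t + n, (2 * n + 2) * t - (2 * n + 2)), P3),
      (P3, ((2 * n + 2) * t - (2 * n + 2), (n^2 - n - 2) * t + n), P4),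
      (P4, ((n^2 - 1) * t + n - 2, (n + 1) * t - (n + 3)), P5),
      (P5, ((n^2 + n) * t - (2 * n + 2), (n^2 + n) * t - (2 * n + 2)), P1),
      (P5, ((n^2 + n) * t - (2 * n + 3), 1), Node 0 0),
      (Node 0 0, (1, (n^2 + n) * t - (2 * n + 3)), P1),
      (Node 0 0, (0, 0), Node 0 0)}"
proof -
  \<comment> \<open>With \<open>m\<close> and \<open>q\<close> replaced by their products, the
    stated coordinates and labels are the locale's up to expansion.\<close>
  interpret young_parameters t n "n * t" "n * (n * t)" g k
    using assms by unfold_locales (auto simp: power2_eq_square algebra_simps)
  show ?thesis
    using Y_graph_in_Z verts_Y_graph arcs_Y_graph
    unfolding young_nodes_def young_arcs_def assms
    by (simp add: power2_eq_square algebra_simps)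
qed

end
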